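(* For each $m\in\mathbb{N}$ with $m>1$ there exists $t_m\in(0,1)$ such that for every $t\in(t_m,1)$ the following holds: with \[ \Phi_t(z)=\left(\frac{z-t}{1-tz}\right)^2\left(\frac{z-t^{1/m}}{1-t^{1/m}z}\right), \] the numerical range $W(M_{\Phi_t})$ contains a pseudohyperbolic disk with radius $\frac{1}{\sqrt2}$; that is, there is a $z_0\in\mathbb{D}$ with $D_\rho\left(z_0,\tfrac{1}{\sqrt2}\right)\subseteq W(M_{\Phi_t})$.
   Context: $\mathbb{D}$ is the open unit disk in $\mathbb{C}$. For an $n\times n$ complex matrix $A$, the numerical range is $W(A)=\{\langle Ax,x\rangle : x\in\mathbb{C}^n,\ \|x\|=1\}$. For $z_0\in\mathbb{D}$ and $r\in(0,1)$, the pseudohyperbolic disk with center $z_0$ and radius $r$ is $D_\rho(z_0,r)=\{z\in\mathbb{D}: |\frac{z-z_0}{1-\overline{z_0}z}|<r\}$. For a finite Blaschke product $\Theta(z)=\prod_{j=1}^n\frac{z-a_j}{1-\overline{a_j}z}$ with zeros $a_1,\dots,a_n\in\mathbb{D}$ (listed with multiplicity), $M_\Theta$ is the upper triangular $n\times n$ matrix with entries $(M_\Theta)_{ii}=a_i$, $(M_\Theta)_{ij}=0$ for $i>j$, and $(M_\Theta)_{ij}=\sqrt{1-|a_i|^2}\sqrt{1-|a_j|^2}\prod_{k=i+1}^{j-1}(-\overline{a_k})$ for $i<j$ (an empty product equals $1$). For $\Phi_t$ we have $n=3$ and the zeros are listed in the order $t,t,t^{1/m}$. *)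

theory Defs
  imports Complex_Main "Jordan_Normal_Form.Matrix"
begin

definition unit_disk :: "complex set" where
  "unit_disk = {z. cmod z < 1}"

definition pseudohyperbolic_disk :: "complex \<Rightarrow> real \<Rightarrow> complex set" where
  "pseudohyperbolic_disk z0 r =
     {z \<in> unit_disk. cmod ((z - z0) / (1 - cnj z0 * z)) < r}"

definition vec_norm :: "complex vec \<Rightarrow> real" where
  "vec_norm x = sqrt (Re (x \<bullet>c x))"

definition numerical_range :: "complex mat \<Rightarrow> complex set" where
  "numerical_range A =
     {(A *\<^sub>v x) \<bullet>c x | x. x \<in> carrier_vec (dim_col A) \<and> vec_norm x = 1}"

definition blaschke_product_with_zeros :: "(complex \<Rightarrow> complex) \<Rightarrow> complex list \<Rightarrow> bool" where
  "blaschke_product_with_zeros \<Theta> as \<longleftrightarrow>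
     set as \<subseteq> unit_disk \<and>
     (\<forall>z \<in> unit_disk. \<Theta> z =
        (\<Prod>j<length as. (z - as ! j) / (1 - cnj (as ! j) * z)))"

text \<open>
  The matrix M depends on the order in which the zeros are listed, so it is a function of the
  list of zeros rather than of the Blaschke product. Indices start at 0.
\<close>

definition blaschke_matrix :: "complex list \<Rightarrow> complex mat" where
  "blaschke_matrix as = mat (length as) (length as) (\<lambda>(i, j).
     if i = j then as ! i
     else if i < j then
       complex_of_real (sqrt (1 - (cmod (as ! i))\<^sup>2) * sqrt (1 - (cmod (as ! j))\<^sup>2))
         * (\<Prod>k \<in> {i<..<j}. - cnj (as ! k))
     else 0)"

definition Phi :: "nat \<Rightarrow> real \<Rightarrow> complex \<Rightarrow> complex" where
  "Phi m t z =
     ((z - of_real t) / (1 - of_real t * z))\<^sup>2 *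
     ((z - of_real (t powr (1 / real m))) / (1 - of_real (t powr (1 / real m)) * z))"

definition Phi_zeros :: "nat \<Rightarrow> real \<Rightarrow> complex list" where
  "Phi_zeros m t = [of_real t, of_real t, of_real (t powr (1 / real m))]"

end

(* The leading 2x2 block of M has the entries t, 1 - t^2; 0, t, so its numerical range is the
   closed Euclidean disk with center t and radius (1 - t^2)/2. For real z0 the pseudohyperbolic disk
   D_rho(z0, 1/sqrt 2) is the Euclidean disk with center z0/(2 - z0^2) and radius
   sqrt 2 (1 - z0^2)/(2 - z0^2). If z0 is chosen such that the two centers agree, the ratio of the
   second radius to the first tends to 2 sqrt 2 / 3 < 1 as t tends to 1. The third zero
   plays no role. *)

theory Submission
  imports Defs
begin

text \<open>It suffices to take \<open>x = a\<close> real and \<open>y = b * sgn u\<close> with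
  \<open>a * b = cmod u\<close> and \<open>a\<^sup>2 + b\<^sup>2 = 1\<close>. These two equations
  amount to (a + b)^2 = 1 + 2 |u| and (a - b)^2 = 1 - 2 |u|, so \<open>p\<close> and
  \<open>q\<close> serve as a + b and a - b; the bound on \<open>u\<close> makes the second root
  real.\<close>

lemma unit_vector_with_product:
  fixes u :: complex
  assumes "cmod u \<le> 1 / 2"
  obtains x y :: complex where "(cmod x)\<^sup>2 + (cmod y)\<^sup>2 = 1" "y * cnj x = u"
proof -
  define p q where "p = sqrt (1 + 2 * cmod u)" and "q = sqrt (1 - 2 * cmod u)"
  have sq: "p\<^sup>2 = 1 + 2 * cmod u" "q\<^sup>2 = 1 - 2 * cmod u"
    using assms by (auto simp: p_def q_def)
  define a b where "a = (p + q) / 2" and "b = (p - q) / 2"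
  have ab: "a * b = cmod u"
    using sq by (simp add: a_def b_def field_simps power2_eq_square)
  have sum: "a\<^sup>2 + b\<^sup>2 = 1"
    using sq by (simp add: a_def b_def field_simps power2_eq_square)
  show thesis
  proof (cases "u = 0")
    case True
    show thesis by (rule that[of 1 0]) (use True in auto)
  next
    case False
    show thesis
    proof (rule that)
      show "(cmod (of_real a))\<^sup>2 + (cmod (of_real b * sgn u))\<^sup>2 = 1"
        using False sum by (simp add: norm_mult norm_sgn)
      have "of_real b * sgn u * cnj (of_real a) = of_real (a * b) * sgn u"
        by simp
      also have "\<dots> = u"
        unfolding ab using False by (simp add: sgn_div_norm scaleR_conv_of_real)
      finally show "of_real b * sgn u * cnj (of_real a) = u" .
    qed
  qed
qed

text \<open>On a unit vector (x, y, 0) the quadratic form of the matrix is t + (1 - t^2) y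
  \<open>cnj x\<close>, and y \<open>cnj x\<close> takes every value of modulus at most 1/2.\<close>

lemma disk_subset_numerical_range:
  fixes t :: real and s :: complex
  assumes "\<bar>t\<bar> < 1"
  shows "{z. cmod (z - of_real t) \<le> (1 - t\<^sup>2) / 2} \<subseteq>
    numerical_range (blaschke_matrix [of_real t, of_real t, s])"
proof
  fix z assume "z \<in> {z. cmod (z - of_real t) \<le> (1 - t\<^sup>2) / 2}"
  then have z: "cmod (z - of_real t) \<le> (1 - t\<^sup>2) / 2" by simp
  have t: "t\<^sup>2 < 1" using assms by (simp add: abs_square_less_1)
  define u where "u = (z - of_real t) / of_real (1 - t\<^sup>2)"
  have zu: "z = of_real t + of_real (1 - t\<^sup>2) * u"
    using t by (simp add: u_def del: of_real_diff)
  have "cmod u \<le> 1 / 2"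
    using z t by (simp add: u_def norm_divide field_simps del: of_real_diff)
  then obtain x y where xy: "(cmod x)\<^sup>2 + (cmod y)\<^sup>2 = 1" "y * cnj x = u"
    by (rule unit_vector_with_product)
  let ?A = "blaschke_matrix [of_real t, of_real t, s]"
  define v :: "complex vec" where "v = vec 3 (\<lambda>i. [x, y, 0] ! i)"
  have dims: "v \<in> carrier_vec 3" "?A \<in> carrier_mat 3 3"
    by (auto simp: v_def blaschke_matrix_def)
  have cxy: "x * cnj x + y * cnj y = 1"
    using xy(1) by (metis complex_norm_square of_real_1 of_real_add)
  have "v \<bullet>c v = x * cnj x + y * cnj y"
    by (simp add: v_def scalar_prod_def eval_nat_numeral)
  then have norm: "vec_norm v = 1"
    by (simp add: vec_norm_def cxy)
  \<comment> \<open>Both facts evaluate the entry (0, 1): its product over k is empty, and the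
    product of its two equal square roots simplifies to an absolute value.\<close>
  have "{0<..<Suc 0} = {}" "\<bar>1 - t\<^sup>2\<bar> = 1 - t\<^sup>2"
    using t by auto
  then have "(?A *\<^sub>v v) \<bullet>c v =
      of_real t * (x * cnj x + y * cnj y) + of_real (1 - t\<^sup>2) * (y * cnj x)"
    by (simp add: v_def blaschke_matrix_def scalar_prod_def numeral_3_eq_3 algebra_simps
        flip: of_real_mult)
  then have "(?A *\<^sub>v v) \<bullet>c v = z"
    by (simp add: cxy xy(2) zu)
  then show "z \<in> numerical_range ?A"
    using dims norm unfolding numerical_range_def by fastforce
qed

lemma pseudohyperbolic_disk_subset_disk:
  fixes z0 :: real
  assumes "\<bar>z0\<bar> < 1"
  shows "pseudohyperbolic_disk (of_real z0) (1 / sqrt 2) \<subseteq>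
    {z. cmod (z - of_real (z0 / (2 - z0\<^sup>2))) \<le> sqrt 2 * (1 - z0\<^sup>2) / (2 - z0\<^sup>2)}"
proof
  fix z assume z: "z \<in> pseudohyperbolic_disk (of_real z0) (1 / sqrt 2)"
  have z0: "z0\<^sup>2 < 1" using assms by (simp add: abs_square_less_1)
  obtain x y where xy: "z = Complex x y" by (cases z)
  \<comment> \<open>Since division by zero yields 0, the denominator has to be shown nonzero before
    the fraction is cleared.\<close>
  have "cmod (of_real z0 * z) < 1"
    using z assms mult_strict_mono'[of "\<bar>z0\<bar>" 1 "cmod z" 1]
    by (simp add: pseudohyperbolic_disk_def unit_disk_def norm_mult)
  then have "0 < cmod (1 - of_real z0 * z)" by auto
  moreover have "cmod (z - of_real z0) / cmod (1 - of_real z0 * z) < 1 / sqrt 2"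
    using z by (simp add: pseudohyperbolic_disk_def norm_divide)
  ultimately have "sqrt 2 * cmod (z - of_real z0) < cmod (1 - of_real z0 * z)"
    by (simp add: pos_divide_less_eq pos_less_divide_eq mult.commute)
  then have "(sqrt 2 * cmod (z - of_real z0))\<^sup>2 \<le> (cmod (1 - of_real z0 * z))\<^sup>2"
    by (intro power_mono) auto
  then have ineq: "2 * ((x - z0)\<^sup>2 + y\<^sup>2) \<le> (1 - z0 * x)\<^sup>2 + (z0 * y)\<^sup>2"
    by (simp add: xy cmod_power2 power_mult_distrib)
  define d where "d = 2 - z0\<^sup>2"
  have d: "d > 0" using z0 by (simp add: d_def)
  \<comment> \<open>The squared inequality has leading part d (x^2 + y^2); multiplying by
    \<open>d\<close> completes the square without fractions.\<close>
  have "(d * x - z0)\<^sup>2 + (d * y)\<^sup>2 - 2 * (1 - z0\<^sup>2)\<^sup>2 =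
      d * (2 * ((x - z0)\<^sup>2 + y\<^sup>2) - ((1 - z0 * x)\<^sup>2 + (z0 * y)\<^sup>2))"
    by (simp add: d_def power2_eq_square algebra_simps)
  also have "\<dots> \<le> 0"
    using d ineq by (simp add: mult_le_0_iff)
  finally have "(d * x - z0)\<^sup>2 + (d * y)\<^sup>2 \<le> (sqrt 2 * (1 - z0\<^sup>2))\<^sup>2"
    by (simp add: power_mult_distrib)
  moreover have "d * cmod (z - of_real (z0 / d)) = cmod (of_real d * (z - of_real (z0 / d)))"
    using d by (simp add: norm_mult)
  moreover have "of_real d * (z - of_real (z0 / d)) = Complex (d * x - z0) (d * y)"
    using d by (simp add: xy complex_eq_iff right_diff_distrib)
  ultimately have "(d * cmod (z - of_real (z0 / d)))\<^sup>2 \<le> (sqrt 2 * (1 - z0\<^sup>2))\<^sup>2"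
    by (simp add: cmod_power2)
  then have "d * cmod (z - of_real (z0 / d)) \<le> sqrt 2 * (1 - z0\<^sup>2)"
    by (rule power2_le_imp_le) (use z0 in auto)
  then show "z \<in> {z. cmod (z - of_real (z0 / (2 - z0\<^sup>2))) \<le> sqrt 2 * (1 - z0\<^sup>2) / (2 - z0\<^sup>2)}"
    using d by (simp add: d_def pos_le_divide_eq mult.commute)
qed

text \<open>Intermediate values on [24/25, 1]: the function z / (2 - z^2) equals 300/337 < 9/10 at
  the left end and 1 at the right end. The lower bound on \<open>z0\<close> is what
  \<open>radius_bound\<close> requires.\<close>

lemma exists_pseudohyperbolic_center:
  fixes t :: real
  assumes "9 / 10 < t" "t < 1"
  obtains z0 :: real where "24 / 25 \<le> z0" "z0 < 1" "z0 / (2 - z0\<^sup>2) = t"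
proof -
  have pos: "2 - z\<^sup>2 \<noteq> 0" if "24 / 25 \<le> z" "z \<le> 1" for z :: real
    using that power_mono[of z 1 2] by auto
  have "\<exists>z\<ge>24 / 25. z \<le> 1 \<and> z / (2 - z\<^sup>2) = t"
    by (rule IVT') (use assms pos in \<open>auto intro!: continuous_intros simp: power_divide\<close>)
  then obtain z where "24 / 25 \<le> z" "z \<le> 1" "z / (2 - z\<^sup>2) = t" by blast
  moreover from this have "z \<noteq> 1" using assms by auto
  ultimately show thesis by (intro that) auto
qed

text \<open>With w = z0^2 both sides carry the factor 1 - w, and the claim reduces to 2 sqrt 2 (2 -
  w) \<le> 4 - w, which at w = 1 is 2 sqrt 2 \<le> 3 and persists for w near 1.\<close>

lemma radius_bound:
  fixes z0 :: real
  assumes "24 / 25 \<le> z0" "z0 < 1"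
  shows "sqrt 2 * (1 - z0\<^sup>2) / (2 - z0\<^sup>2) \<le> (1 - (z0 / (2 - z0\<^sup>2))\<^sup>2) / 2"
proof -
  define w where "w = z0\<^sup>2"
  have w: "(24 / 25)\<^sup>2 \<le> w" "w < 1"
    using assms power_mono[of "24 / 25" z0 2] by (auto simp: w_def abs_square_less_1)
  \<comment> \<open>With this bound the reduced inequality holds for w \<ge> 166/183, which lies
    below (24/25)^2; the cruder bound 3/2 would force w \<ge> 1.\<close>
  have "sqrt 2 \<le> 283 / 200"
    by (rule real_le_lsqrt) (auto simp: power2_eq_square)
  then have "2 * sqrt 2 * (2 - w) \<le> 2 * (283 / 200) * (2 - w)"
    using w by (intro mult_right_mono) auto
  also have "\<dots> \<le> 4 - w" using w by (simp add: power2_eq_square)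
  finally have *: "2 * sqrt 2 * (2 - w) \<le> 4 - w" .
  have e: "2 - w \<noteq> 0" using w by simp
  then have "sqrt 2 * (1 - w) / (2 - w) = (1 - w) * (2 * sqrt 2 * (2 - w)) / (2 * (2 - w)\<^sup>2)"
    by (simp add: power2_eq_square)
  also have "\<dots> \<le> (1 - w) * (4 - w) / (2 * (2 - w)\<^sup>2)"
    using w * by (intro divide_right_mono mult_left_mono) auto
  also have "\<dots> = (1 - w / (2 - w)\<^sup>2) / 2"
  proof -
    have "(1 - w) * (4 - w) = (2 - w)\<^sup>2 - w"
      by (simp add: power2_eq_square algebra_simps)
    then show ?thesis using e by (simp add: diff_divide_distrib)
  qed
  finally show ?thesis by (simp add: w_def power_divide)
qed

lemma blaschke_product_with_zeros_Phi:
  assumes "m > 0" "0 < t" "t < 1"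
  shows "blaschke_product_with_zeros (Phi m t) (Phi_zeros m t)"
proof -
  have "t powr (1 / real m) < 1"
    using assms powr_less_mono2[of "1 / real m" t 1] by simp
  then show ?thesis
    using assms unfolding blaschke_product_with_zeros_def
    by (auto simp: Phi_def Phi_zeros_def unit_disk_def eval_nat_numeral)
qed

theorem theorem2p7:
  fixes m :: nat
  assumes "m > 1"
  shows "\<exists>t\<^sub>m::real. 0 < t\<^sub>m \<and> t\<^sub>m < 1 \<and>
    (\<forall>t::real. t\<^sub>m < t \<and> t < 1 \<longrightarrow>
      blaschke_product_with_zeros (Phi m t) (Phi_zeros m t) \<and>
      (\<exists>z0 \<in> unit_disk.
        pseudohyperbolic_disk z0 (1 / sqrt 2) \<subseteq> numerical_range (blaschke_matrix (Phi_zeros m t))))"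
\<comment> \<open>The threshold comes from \<open>exists_pseudohyperbolic_center\<close> and is the
  same for every \<open>m\<close>.\<close>
proof (rule exI[of _ "9 / 10"], safe)
  fix t :: real assume t: "9 / 10 < t" "t < 1"
  show "blaschke_product_with_zeros (Phi m t) (Phi_zeros m t)"
    using assms t by (intro blaschke_product_with_zeros_Phi) auto
  obtain z0 where z0: "24 / 25 \<le> z0" "z0 < 1" "z0 / (2 - z0\<^sup>2) = t"
    using exists_pseudohyperbolic_center[OF t] .
  have "pseudohyperbolic_disk (of_real z0) (1 / sqrt 2) \<subseteq>
      {z. cmod (z - of_real t) \<le> sqrt 2 * (1 - z0\<^sup>2) / (2 - z0\<^sup>2)}"
    using pseudohyperbolic_disk_subset_disk[of z0] z0 by simp
  \<comment> \<open>By the choice of \<open>z0\<close> the two disks are concentric, so only their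
    radii need comparing.\<close>
  also have "\<dots> \<subseteq> {z. cmod (z - of_real t) \<le> (1 - t\<^sup>2) / 2}"
    using radius_bound[OF z0(1,2)] unfolding z0(3) by (blast intro: order_trans)
  also have "\<dots> \<subseteq> numerical_range (blaschke_matrix (Phi_zeros m t))"
    unfolding Phi_zeros_def by (rule disk_subset_numerical_range) (use t in auto)
  finally show "\<exists>z0 \<in> unit_disk.
      pseudohyperbolic_disk z0 (1 / sqrt 2) \<subseteq> numerical_range (blaschke_matrix (Phi_zeros m t))"
    using z0 by (intro bexI[of _ "of_real z0"]) (auto simp: unit_disk_def)
qed auto

end
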